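(* Let $G$ be a semisimple algebraic group over $\mathbb{C}$ with Borel subgroup $B$ and maximal torus $T\subset B$, let $Q\supset B$ be a maximal parabolic subgroup of $G$, and let $P=P_{\omega_i}\supset B$ be the maximal parabolic subgroup associated to a cominuscule fundamental weight $\omega_i$. For $w\in W$ put $$\delta(w):=\eta_Q\bigl(\omega_i^\vee-w^{-1}(\omega_i^\vee)\bigr)\in\mathbb{Z}.$$ Then the loci $\{w\in W^Q\mid \delta(w)=d\}$ coincide with the sets $\mathcal{E}\cap W^Q$, where $\mathcal{E}$ runs over the double cosets in $W_P\backslash W/W_Q$ (which index the $P$-orbits in $G/Q$). That is, every set $\mathcal{E}\cap W^Q$ is equal to $\{w\in W^Q\mid\delta(w)=d\}$ for some integer $d$, and every non-empty set $\{w\in W^Q\mid\delta(w)=d\}$ is equal to $\mathcal{E}\cap W^Q$ for some double coset $\mathcal{E}\in W_P\backslash W/W_Q$.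
   Context: $W$ is the Weyl group of $(G,T)$; $\alpha_1,\dots,\alpha_n$ are the simple roots determined by $B$; $\alpha_j^\vee$ are the simple coroots; $\omega_i$ are the fundamental weights and $\omega_i^\vee$ the fundamental coweights. A fundamental weight $\omega$ is minuscule if $|\langle\alpha^\vee,\omega\rangle|\le 1$ for all roots $\alpha$, and cominuscule if it is minuscule for the dual root system. $P_{\omega_i}$ is the parabolic subgroup generated by $B$ and the simple reflections $s_l$, $l\neq i$. $W_P$ and $W_Q$ are the Weyl groups of $P$ and $Q$, viewed as subgroups of $W$, and $W^Q$ is the set of minimal length representatives of the cosets in $W/W_Q$. The $P$-orbits of $G/Q$ are the $PwQ/Q$ with $w\in W$, and are indexed by the double cosets $W_PwW_Q$. Let $\Phi^\vee$ be the coroot lattice of $G$ and $\Phi^\vee_Q$ the coroot lattice of $Q$ (spanned by the simple coroots whose reflections lie in $W_Q$). The map $\eta_Q:\Phi^\vee\to\Phi^\vee/\Phi_Q^\vee$ is the natural surjection. Since $Q$ is maximal, associated to a simple root $\alpha_m$, one has $\Phi^\vee/\Phi^\vee_Q\cong\mathbb{Z}$, and $\eta_Q$ takes the coefficient of $\alpha_m^\vee$. Note that $\omega_i^\vee-w^{-1}(\omega_i^\vee)$ belongs to $\Phi^\vee$. *)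

theory Defs
  imports Complex_Main "HOL-Algebra.Bij" "HOL-Algebra.Coset" "HOL-Algebra.Elementary_Groups"
begin

text \<open>
  A triple of a complex semisimple algebraic group \<open>G\<close>, a maximal torus \<open>T\<close> and a Borel subgroup
  \<open>B \<supseteq> T\<close> enters through its based root datum, which determines it up to isomorphism; conversely every
  (reduced) semisimple based root datum arises from such a triple.
  The types \<open>'x\<close> and \<open>'y\<close> are the real vector spaces spanned by the character lattice
  and by the cocharacter lattice of \<open>T\<close>, so that fundamental weights and coweights, which need not
  be characters or cocharacters, live in them as well.
\<close>

record ('x, 'y) based_root_datum =
  pairing :: "'x \<Rightarrow> 'y \<Rightarrow> real"
  characters :: "'x set"
  cocharacters :: "'y set"
  roots :: "'x set"
  coroot :: "'x \<Rightarrow> 'y"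
  simple_roots :: "'x set"

definition int_span :: "'v::real_vector set \<Rightarrow> 'v set" where
  "int_span S = {\<Sum>v\<in>A. of_int (c v) *\<^sub>R v | (A :: 'v set) (c :: 'v \<Rightarrow> int). finite A \<and> A \<subseteq> S}"

text \<open>
  A pairing of two full lattices is perfect over the integers iff they have bases dual to each other.
\<close>

definition perfect_lattice_pairing ::
  "('x::real_vector \<Rightarrow> 'y::real_vector \<Rightarrow> real) \<Rightarrow> 'x set \<Rightarrow> 'y set \<Rightarrow> bool" where
  "perfect_lattice_pairing p X Y \<longleftrightarrow>
     (\<forall>y. linear (\<lambda>x. p x y)) \<and> (\<forall>x. linear (\<lambda>y. p x y)) \<and>
     (\<exists>(n::nat) b c.
        X = int_span (b ` {..<n}) \<and> span (b ` {..<n}) = UNIV \<and>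
        Y = int_span (c ` {..<n}) \<and> span (c ` {..<n}) = UNIV \<and>
        (\<forall>i<n. \<forall>j<n. p (b i) (c j) = (if i = j then 1 else 0)))"

definition root_reflection ::
  "('x::real_vector, 'y::real_vector) based_root_datum \<Rightarrow> 'x \<Rightarrow> 'x \<Rightarrow> 'x" where
  "root_reflection D \<alpha> x = x - pairing D x (coroot D \<alpha>) *\<^sub>R \<alpha>"

definition coroot_reflection ::
  "('x::real_vector, 'y::real_vector) based_root_datum \<Rightarrow> 'x \<Rightarrow> 'y \<Rightarrow> 'y" where
  "coroot_reflection D \<alpha> y = y - pairing D \<alpha> y *\<^sub>R coroot D \<alpha>"

definition is_root_datum :: "('x::real_vector, 'y::real_vector) based_root_datum \<Rightarrow> bool" where
  "is_root_datum D \<longleftrightarrow>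
     perfect_lattice_pairing (pairing D) (characters D) (cocharacters D) \<and>
     finite (roots D) \<and> roots D \<subseteq> characters D \<and> coroot D ` roots D \<subseteq> cocharacters D \<and>
     inj_on (coroot D) (roots D) \<and>
     (\<forall>\<alpha>\<in>roots D. pairing D \<alpha> (coroot D \<alpha>) = 2 \<and>
        root_reflection D \<alpha> ` roots D = roots D \<and>
        coroot_reflection D \<alpha> ` (coroot D ` roots D) = coroot D ` roots D)"

definition is_base :: "('x::real_vector, 'y::real_vector) based_root_datum \<Rightarrow> bool" where
  "is_base D \<longleftrightarrow>
     simple_roots D \<subseteq> roots D \<and> independent (simple_roots D) \<and>
     (\<forall>\<alpha>\<in>roots D. \<exists>c :: 'x \<Rightarrow> nat.
        \<alpha> = (\<Sum>\<beta>\<in>simple_roots D. of_nat (c \<beta>) *\<^sub>R \<beta>) \<or>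
        \<alpha> = - (\<Sum>\<beta>\<in>simple_roots D. of_nat (c \<beta>) *\<^sub>R \<beta>))"

definition semisimple_based_root_datum ::
  "('x::real_vector, 'y::real_vector) based_root_datum \<Rightarrow> bool" where
  "semisimple_based_root_datum D \<longleftrightarrow>
     is_root_datum D \<and>
     (\<forall>\<alpha>\<in>roots D. 2 *\<^sub>R \<alpha> \<notin> roots D) \<and>
     span (roots D) = UNIV \<and>
     is_base D"

definition dual_datum :: "('x, 'y) based_root_datum \<Rightarrow> ('y, 'x) based_root_datum" where
  "dual_datum D =
     \<lparr> pairing = (\<lambda>y x. pairing D x y),
       characters = cocharacters D,
       cocharacters = characters D,
       roots = coroot D ` roots D,
       coroot = the_inv_into (roots D) (coroot D),
       simple_roots = coroot D ` simple_roots D \<rparr>"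

text \<open>Fundamental weights, and everything else indexed by the simple roots in the usual
  notation, are indexed here by the simple root itself.\<close>

definition fundamental_weight :: "('x, 'y) based_root_datum \<Rightarrow> 'x \<Rightarrow> 'x" where
  "fundamental_weight D \<alpha> =
     (THE x. \<forall>\<beta>\<in>simple_roots D. pairing D x (coroot D \<beta>) = (if \<beta> = \<alpha> then 1 else 0))"

definition fundamental_coweight :: "('x, 'y) based_root_datum \<Rightarrow> 'x \<Rightarrow> 'y" where
  "fundamental_coweight D \<alpha> = fundamental_weight (dual_datum D) (coroot D \<alpha>)"

definition minuscule :: "('x, 'y) based_root_datum \<Rightarrow> 'x \<Rightarrow> bool" where
  "minuscule D \<alpha> \<longleftrightarrow>
     (\<forall>\<beta>\<in>roots D. \<bar>pairing D (fundamental_weight D \<alpha>) (coroot D \<beta>)\<bar> \<le> 1)"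

definition cominuscule :: "('x, 'y) based_root_datum \<Rightarrow> 'x \<Rightarrow> bool" where
  "cominuscule D \<alpha> \<longleftrightarrow> minuscule (dual_datum D) (coroot D \<alpha>)"

text \<open>The Weyl group is realised by its faithful action on the cocharacter space.\<close>

definition weyl_group :: "('x::real_vector, 'y::real_vector) based_root_datum \<Rightarrow> ('y \<Rightarrow> 'y) monoid" where
  "weyl_group D = subgroup_generated (BijGroup UNIV) (coroot_reflection D ` roots D)"

definition weyl_length ::
  "('x::real_vector, 'y::real_vector) based_root_datum \<Rightarrow> ('y \<Rightarrow> 'y) \<Rightarrow> nat" where
  "weyl_length D w =
     (LEAST k. \<exists>\<beta>s. length \<beta>s = k \<and> set \<beta>s \<subseteq> simple_roots D \<and>
        w = foldr (\<lambda>\<beta> v. coroot_reflection D \<beta> \<otimes>\<^bsub>weyl_group D\<^esub> v) \<beta>s \<one>\<^bsub>weyl_group D\<^esub>)"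

text \<open>
  The parabolic subgroups containing \<open>B\<close> correspond to the sets \<open>J\<close> of simple roots whose reflections
  lie in their Weyl group. The maximal ones omit exactly one simple root \<open>\<alpha>\<close>, and the one
  generated by \<open>B\<close> and the simple reflections other than that of \<open>\<alpha>\<close> has the set
  \<open>maximal_type D \<alpha>\<close>.
\<close>

definition maximal_type :: "('x, 'y) based_root_datum \<Rightarrow> 'x \<Rightarrow> 'x set" where
  "maximal_type D \<alpha> = simple_roots D - {\<alpha>}"

definition parabolic_weyl_group ::
  "('x::real_vector, 'y::real_vector) based_root_datum \<Rightarrow> 'x set \<Rightarrow> ('y \<Rightarrow> 'y) set" where
  "parabolic_weyl_group D J = generate (weyl_group D) (coroot_reflection D ` J)"

definition minimal_coset_reps ::
  "('x::real_vector, 'y::real_vector) based_root_datum \<Rightarrow> 'x set \<Rightarrow> ('y \<Rightarrow> 'y) set" where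
  "minimal_coset_reps D J =
     {w \<in> carrier (weyl_group D).
        \<forall>v \<in> w <#\<^bsub>weyl_group D\<^esub> parabolic_weyl_group D J. weyl_length D w \<le> weyl_length D v}"

definition double_cosets ::
  "('x::real_vector, 'y::real_vector) based_root_datum \<Rightarrow> 'x set \<Rightarrow> 'x set \<Rightarrow> ('y \<Rightarrow> 'y) set set" where
  "double_cosets D I J =
     {parabolic_weyl_group D I <#>\<^bsub>weyl_group D\<^esub> (w <#\<^bsub>weyl_group D\<^esub> parabolic_weyl_group D J) | w.
        w \<in> carrier (weyl_group D)}"

definition parabolic_coroot_lattice ::
  "('x::real_vector, 'y::real_vector) based_root_datum \<Rightarrow> 'x set \<Rightarrow> 'y set" where
  "parabolic_coroot_lattice D J = int_span (coroot D ` J)"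

text \<open>
  The class of \<open>y\<close> in the quotient of the coroot lattice by that of the maximal parabolic subgroup omitting
  \<open>\<alpha>\<close>; this quotient is identified with the integers by sending the class of the
  coroot of \<open>\<alpha>\<close> to 1.
\<close>

definition eta :: "('x::real_vector, 'y::real_vector) based_root_datum \<Rightarrow> 'x \<Rightarrow> 'y \<Rightarrow> int" where
  "eta D \<alpha> y =
     (THE k. y - of_int k *\<^sub>R coroot D \<alpha> \<in> parabolic_coroot_lattice D (maximal_type D \<alpha>))"

definition delta ::
  "('x::real_vector, 'y::real_vector) based_root_datum \<Rightarrow> 'x \<Rightarrow> 'x \<Rightarrow> ('y \<Rightarrow> 'y) \<Rightarrow> int" where
  "delta D \<alpha>\<^sub>i \<alpha>\<^sub>m w =
     eta D \<alpha>\<^sub>m (fundamental_coweight D \<alpha>\<^sub>i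
                - (inv\<^bsub>weyl_group D\<^esub> w) (fundamental_coweight D \<alpha>\<^sub>i))"

end

theory Submission
  imports Defs
begin

text \<open>
  Pairing with the \<open>m\<close>-th fundamental weight shows that \<open>\<delta>(w)\<close> is, up to a constant, minus the coefficient
  of the coroot of \<open>\<alpha>\<^sub>m\<close> in \<open>w\<^sup>-\<^sup>1 \<omega>\<close>, where \<open>\<omega>\<close> is the cominuscule coweight. The stabiliser of \<open>\<omega>\<close> in \<open>W\<close>
  is \<open>W\<^sub>P\<close>, so double cosets correspond to \<open>W\<^sub>Q\<close>-orbits on \<open>W \<omega>\<close>, and the claim is that two elements
  \<open>u\<close>, \<open>u'\<close> of \<open>W \<omega>\<close> with the same coefficient lie in the same \<open>W\<^sub>Q\<close>-orbit. Choose \<open>u\<close>, \<open>u'\<close> in their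
  orbits such that \<open>u - u'\<close> has the least sum of absolute values of its simple coroot coefficients.
  If \<open>u \<noteq> u'\<close>, positivity of the invariant form gives a simple root \<open>\<alpha> \<noteq> \<alpha>\<^sub>m\<close> whose value on \<open>u - u'\<close>
  has the sign of the coefficient of its coroot; roots take only the values \<open>-1, 0, 1\<close> on \<open>u\<close> and \<open>u'\<close>,
  so reflecting one of the two in \<open>\<alpha>\<close> lowers this sum by one, a contradiction.
\<close>

lemma sum_Nats: "(\<And>i. i \<in> A \<Longrightarrow> f i \<in> \<nat>) \<Longrightarrow> sum f A \<in> \<nat>"
  by (induction A rule: infinite_finite_induct) auto

lemma Nats_real_nonneg: "x \<in> \<nat> \<Longrightarrow> 0 \<le> (x::real)"
  by (auto simp: Nats_def)

lemma sum_pos_term: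
  fixes f :: "'a \<Rightarrow> real"
  assumes "0 < sum f A"
  shows "\<exists>i\<in>A. 0 < f i"
  using assms sum_nonpos[of A f] by (meson not_le)

locale semisimple_datum =
  fixes D :: "('x::real_vector, 'y::real_vector) based_root_datum"
  assumes semisimple: "semisimple_based_root_datum D"
begin

abbreviation pr :: "'x \<Rightarrow> 'y \<Rightarrow> real" where "pr \<equiv> pairing D"
abbreviation R :: "'x set" where "R \<equiv> roots D"
abbreviation S :: "'x set" where "S \<equiv> simple_roots D"
abbreviation ch :: "'x \<Rightarrow> 'y" where "ch \<equiv> coroot D"
abbreviation sx :: "'x \<Rightarrow> 'x \<Rightarrow> 'x" where "sx \<equiv> root_reflection D"
abbreviation sy :: "'x \<Rightarrow> 'y \<Rightarrow> 'y" where "sy \<equiv> coroot_reflection D"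
abbreviation om :: "'x \<Rightarrow> 'y" where "om \<equiv> fundamental_coweight D"

subsection \<open>Perfect pairing and fundamental coweights\<close>

lemma perfect: "perfect_lattice_pairing pr (characters D) (cocharacters D)"
  using semisimple by (simp add: semisimple_based_root_datum_def is_root_datum_def)

lemma linear_pr: "linear (\<lambda>x. pr x y)" "linear (pr x)"
  using perfect by (auto simp: perfect_lattice_pairing_def)

lemmas pr_simps [simp] =
  linear_add[OF linear_pr(1)] linear_add[OF linear_pr(2)]
  linear_diff[OF linear_pr(1)] linear_diff[OF linear_pr(2)]
  linear_neg[OF linear_pr(1)] linear_neg[OF linear_pr(2)]
  linear_scale[OF linear_pr(1)] linear_scale[OF linear_pr(2)]
  linear_0[OF linear_pr(1)] linear_0[OF linear_pr(2)]

lemma finite_R [simp]: "finite R" and finite_S [simp]: "finite S" and S_R: "\<alpha> \<in> S \<Longrightarrow> \<alpha> \<in> R"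
  using semisimple finite_subset
  by (auto simp: semisimple_based_root_datum_def is_root_datum_def is_base_def)

lemma pr_coroot [simp]: "\<alpha> \<in> R \<Longrightarrow> pr \<alpha> (ch \<alpha>) = 2"
  and sx_image: "\<alpha> \<in> R \<Longrightarrow> sx \<alpha> ` R = R"
  using semisimple by (auto simp: semisimple_based_root_datum_def is_root_datum_def)

lemma inj_coroot: "inj_on ch R"
  using semisimple by (auto simp: semisimple_based_root_datum_def is_root_datum_def)

lemma base_cases:
  assumes "\<alpha> \<in> R"
  obtains c :: "'x \<Rightarrow> nat" where
    "\<alpha> = (\<Sum>\<beta>\<in>S. of_nat (c \<beta>) *\<^sub>R \<beta>) \<or> \<alpha> = - (\<Sum>\<beta>\<in>S. of_nat (c \<beta>) *\<^sub>R \<beta>)"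
  using semisimple assms unfolding semisimple_based_root_datum_def is_base_def by blast

lemma span_S: "span S = UNIV"
proof -
  have "R \<subseteq> span S"
  proof
    fix \<alpha> assume "\<alpha> \<in> R"
    then obtain c :: "'x \<Rightarrow> nat" where
      "\<alpha> = (\<Sum>\<beta>\<in>S. of_nat (c \<beta>) *\<^sub>R \<beta>) \<or> \<alpha> = - (\<Sum>\<beta>\<in>S. of_nat (c \<beta>) *\<^sub>R \<beta>)"
      by (rule base_cases)
    moreover have "(\<Sum>\<beta>\<in>S. of_nat (c \<beta>) *\<^sub>R \<beta>) \<in> span S"
      by (intro span_sum span_scale span_base)
    ultimately show "\<alpha> \<in> span S" using span_neg by metis
  qed
  then have "span R \<subseteq> span S" by (simp add: span_minimal)
  then show ?thesis using semisimple by (auto simp: semisimple_based_root_datum_def)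
qed

text \<open>The representing vector is read off from dual bases \<open>b\<close>, \<open>c\<close>
  of the two lattices. This provides the existence of fundamental coweights.\<close>

lemma functional_represented:
  assumes "linear f"
  shows "\<exists>y. \<forall>x. pr x y = f x"
proof -
  obtain n b c where b: "span (b ` {..<n::nat}) = UNIV"
    and bc: "\<forall>i<n. \<forall>j<n. pr (b i) (c j) = (if i = j then 1 else 0)"
    using perfect unfolding perfect_lattice_pairing_def by metis
  have "pr x (\<Sum>j<n. f (b j) *\<^sub>R c j) = f x" for x
  proof (rule linear_eq_on_span[OF linear_pr(1) assms, where B = "b ` {..<n}"])
    show "x \<in> span (b ` {..<n})" by (simp add: b)
    fix x' assume "x' \<in> b ` {..<n}"
    then obtain i where i: "i < n" "x' = b i" by auto
    have "pr x' (\<Sum>j<n. f (b j) *\<^sub>R c j) = (\<Sum>j<n. f (b j) * (if i = j then 1 else 0))"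
      using i bc by (simp add: linear_sum[OF linear_pr(2)])
    then show "pr x' (\<Sum>j<n. f (b j) *\<^sub>R c j) = f x'"
      using i by (simp add: if_distrib cong: if_cong)
  qed
  then show ?thesis by blast
qed

text \<open>The numbers \<open>pr (b j) y\<close> are the coordinates of \<open>y\<close> in the
  basis \<open>c\<close>, and they vanish because the simple roots span.\<close>

lemma pr_nondegenerate:
  assumes "\<And>\<alpha>. \<alpha> \<in> S \<Longrightarrow> pr \<alpha> y = 0"
  shows "y = 0"
proof -
  obtain n b c where c: "span (c ` {..<n::nat}) = UNIV"
    and bc: "\<forall>i<n. \<forall>j<n. pr (b i) (c j) = (if i = j then 1 else 0)"
    using perfect unfolding perfect_lattice_pairing_def by metis
  have 0: "pr x y = 0" for x
    by (rule linear_eq_0_on_span[OF linear_pr(1), where b = S]) (auto simp: assms span_S)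
  have lin: "linear (\<lambda>y. \<Sum>j<n. pr (b j) y *\<^sub>R c j)"
    by (rule linearI) (simp_all add: sum.distrib scaleR_add_left scaleR_sum_right)
  have "(\<Sum>j<n. pr (b j) y *\<^sub>R c j) = y"
  proof (rule linear_eq_on_span[OF lin linear_ident, where B = "c ` {..<n}"])
    show "y \<in> span (c ` {..<n})" by (simp add: c)
    fix y' assume "y' \<in> c ` {..<n}"
    then obtain i where i: "i < n" "y' = c i" by auto
    have "(\<Sum>j<n. pr (b j) y' *\<^sub>R c j) = (\<Sum>j<n. if j = i then c j else 0)"
      using i bc by (intro sum.cong) auto
    then show "(\<Sum>j<n. pr (b j) y' *\<^sub>R c j) = y'" using i by simp
  qed
  with 0 show ?thesis by simp
qed

text \<open>Makes the definite description behind \<open>om\<close> usable: independence of the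
  simple roots gives existence, \<open>pr_nondegenerate\<close> gives uniqueness.\<close>

lemma pr_fundamental_coweight:
  assumes "\<alpha> \<in> S" "\<beta> \<in> S"
  shows "pr \<beta> (om \<alpha>) = (if \<beta> = \<alpha> then 1 else 0)"
proof -
  let ?P = "\<lambda>y. \<forall>\<beta>\<in>S. pr \<beta> y = (if \<beta> = \<alpha> then 1 else 0)"
  have "independent S"
    using semisimple by (simp add: semisimple_based_root_datum_def is_base_def)
  then obtain f :: "'x \<Rightarrow> real" where "linear f" "\<forall>\<beta>\<in>S. f \<beta> = (if \<beta> = \<alpha> then 1 else 0)"
    using linear_independent_extend[of S "\<lambda>\<beta>. if \<beta> = \<alpha> then 1 else 0"] by blast
  moreover from this(1) obtain y where "\<forall>x. pr x y = f x" using functional_represented by blast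
  ultimately have y: "?P y" by simp
  have unique: "y' = y" if "?P y'" for y'
    using pr_nondegenerate[of "y' - y"] that y by simp
  \<comment> \<open>\<open>om\<close> is a fundamental weight of the dual datum, whose coroot map
    inverts \<open>ch\<close>; injectivity of \<open>ch\<close> turns its defining condition into
    \<open>?P\<close>.\<close>
  have "the_inv_into R ch (ch \<beta>) = \<beta>" if "\<beta> \<in> S" for \<beta>
    using that by (simp add: the_inv_into_f_f inj_coroot S_R)
  moreover have "ch \<beta> = ch \<alpha> \<longleftrightarrow> \<beta> = \<alpha>" if "\<beta> \<in> S" for \<beta>
    by (rule inj_on_eq_iff[OF inj_coroot S_R[OF that] S_R[OF assms(1)]])
  ultimately have "om \<alpha> = (THE y. ?P y)"
    unfolding fundamental_coweight_def fundamental_weight_def dual_datum_def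
    by (intro arg_cong[where f = The] ext) simp
  also have "\<dots> = y" using y unique by (rule the_equality)
  finally show ?thesis using y assms by simp
qed

text \<open>Simple roots and fundamental coweights are dual bases, so coefficients of roots can be
  written as pairings with \<open>om\<close>.\<close>

lemma root_expansion: "x = (\<Sum>\<alpha>\<in>S. pr x (om \<alpha>) *\<^sub>R \<alpha>)"
proof -
  have lin: "linear (\<lambda>x. \<Sum>\<alpha>\<in>S. pr x (om \<alpha>) *\<^sub>R \<alpha>)"
    by (rule linearI) (simp_all add: sum.distrib scaleR_add_left scaleR_sum_right)
  show ?thesis
  proof (rule linear_eq_on_span[OF linear_ident lin, where B = S])
    show "x \<in> span S" by (simp add: span_S)
    fix \<beta> assume \<beta>: "\<beta> \<in> S"
    have "(\<Sum>\<alpha>\<in>S. pr \<beta> (om \<alpha>) *\<^sub>R \<alpha>) = (\<Sum>\<alpha>\<in>S. if \<alpha> = \<beta> then \<alpha> else 0)"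
      using \<beta> by (intro sum.cong) (auto simp: pr_fundamental_coweight)
    then show "\<beta> = (\<Sum>\<alpha>\<in>S. pr \<beta> (om \<alpha>) *\<^sub>R \<alpha>)" using \<beta> by simp
  qed
qed

lemma coweight_expansion: "y = (\<Sum>\<alpha>\<in>S. pr \<alpha> y *\<^sub>R om \<alpha>)"
proof -
  have "pr \<beta> (y - (\<Sum>\<alpha>\<in>S. pr \<alpha> y *\<^sub>R om \<alpha>)) = 0" if "\<beta> \<in> S" for \<beta>
  proof -
    have "pr \<beta> (\<Sum>\<alpha>\<in>S. pr \<alpha> y *\<^sub>R om \<alpha>) = (\<Sum>\<alpha>\<in>S. if \<alpha> = \<beta> then pr \<alpha> y else 0)"
      using that
      by (simp add: linear_sum[OF linear_pr(2)] pr_fundamental_coweight if_distrib cong: if_cong)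
    then show ?thesis using that by simp
  qed
  then show ?thesis using pr_nondegenerate by fastforce
qed

lemma root_sign:
  assumes "\<beta> \<in> R"
  shows "(\<forall>\<alpha>\<in>S. pr \<beta> (om \<alpha>) \<in> \<nat>) \<or> (\<forall>\<alpha>\<in>S. - pr \<beta> (om \<alpha>) \<in> \<nat>)"
proof -
  obtain c :: "'x \<Rightarrow> nat" where c:
    "\<beta> = (\<Sum>\<gamma>\<in>S. of_nat (c \<gamma>) *\<^sub>R \<gamma>) \<or> \<beta> = - (\<Sum>\<gamma>\<in>S. of_nat (c \<gamma>) *\<^sub>R \<gamma>)"
    using assms by (rule base_cases)
  have "pr (\<Sum>\<gamma>\<in>S. of_nat (c \<gamma>) *\<^sub>R \<gamma>) (om \<alpha>) = of_nat (c \<alpha>)" if "\<alpha> \<in> S" for \<alpha>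
  proof -
    have "pr (\<Sum>\<gamma>\<in>S. of_nat (c \<gamma>) *\<^sub>R \<gamma>) (om \<alpha>) = (\<Sum>\<gamma>\<in>S. if \<gamma> = \<alpha> then of_nat (c \<gamma>) else 0)"
      using that
      by (simp add: linear_sum[OF linear_pr(1)] pr_fundamental_coweight if_distrib cong: if_cong)
    then show ?thesis using that by simp
  qed
  with c show ?thesis by auto
qed

subsection \<open>The invariant form and the reflections\<close>

lemma pr_sx: "pr (sx \<alpha> x) y = pr x (sy \<alpha> y)"
  by (simp add: root_reflection_def coroot_reflection_def)

lemma sx_in_R: "\<alpha> \<in> R \<Longrightarrow> \<beta> \<in> R \<Longrightarrow> sx \<alpha> \<beta> \<in> R"
  using sx_image by blast

lemma sx_sx [simp]: "\<alpha> \<in> R \<Longrightarrow> sx \<alpha> (sx \<alpha> x) = x"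
  by (simp add: root_reflection_def)

lemma sy_sy [simp]: "\<alpha> \<in> R \<Longrightarrow> sy \<alpha> (sy \<alpha> y) = y"
  by (simp add: coroot_reflection_def)

lemma pr_sx_sy: "\<alpha> \<in> R \<Longrightarrow> pr (sx \<alpha> x) (sy \<alpha> y) = pr x y"
  by (simp add: pr_sx)

text \<open>The standard Weyl-invariant form. Summing over all roots makes invariance a reindexing,
  since each reflection permutes the roots.\<close>

definition bil :: "'y \<Rightarrow> 'y \<Rightarrow> real" where
  "bil y z = (\<Sum>\<beta>\<in>R. pr \<beta> y * pr \<beta> z)"

lemma linear_bil: "linear (bil y)"
  unfolding bil_def
  by (rule linearI) (simp_all add: distrib_left sum.distrib sum_distrib_left mult_ac)

lemma bil_commute: "bil y z = bil z y"
  by (simp add: bil_def mult.commute)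

lemma linear_bil_left: "linear (\<lambda>y. bil y z)"
  using linear_bil[of z] by (simp add: bil_commute[of _ z])

lemmas bil_simps =
  linear_add[OF linear_bil] linear_add[OF linear_bil_left]
  linear_diff[OF linear_bil] linear_diff[OF linear_bil_left]
  linear_scale[OF linear_bil] linear_scale[OF linear_bil_left]

lemma bil_pos:
  assumes "y \<noteq> 0"
  shows "0 < bil y y"
proof -
  obtain \<alpha> where \<alpha>: "\<alpha> \<in> S" "pr \<alpha> y \<noteq> 0" using pr_nondegenerate assms by blast
  have "0 < pr \<alpha> y * pr \<alpha> y" using \<alpha>(2) not_real_square_gt_zero by blast
  then show ?thesis unfolding bil_def
    by (rule sum_pos2[OF finite_R S_R[OF \<alpha>(1)]]) (rule zero_le_square)
qed

lemma bil_invariant: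
  assumes "\<alpha> \<in> R"
  shows "bil (sy \<alpha> y) (sy \<alpha> z) = bil y z"
proof -
  have "bil (sy \<alpha> y) (sy \<alpha> z) = (\<Sum>\<beta>\<in>R. pr (sx \<alpha> \<beta>) y * pr (sx \<alpha> \<beta>) z)"
    by (simp add: bil_def pr_sx)
  also have "\<dots> = bil y z" unfolding bil_def
    using assms sx_in_R by (intro sum.reindex_bij_witness[of _ "sx \<alpha>" "sx \<alpha>"]) auto
  finally show ?thesis .
qed

text \<open>The reflection negates \<open>ch \<alpha>\<close>, so invariance gives a linear equation
  for \<open>bil y (ch \<alpha>)\<close>.\<close>

lemma bil_coroot:
  assumes "\<alpha> \<in> R"
  shows "bil y (ch \<alpha>) = pr \<alpha> y * bil (ch \<alpha>) (ch \<alpha>) / 2"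
proof -
  have "sy \<alpha> (ch \<alpha>) = - ch \<alpha>"
    using assms by (simp add: coroot_reflection_def scaleR_2)
  then have "bil y (ch \<alpha>) = - bil (sy \<alpha> y) (ch \<alpha>)"
    using bil_invariant[OF assms, of y "ch \<alpha>"] linear_neg[OF linear_bil] by simp
  then show ?thesis by (simp add: coroot_reflection_def bil_simps)
qed

lemma bil_coroot_pos:
  assumes "\<alpha> \<in> R"
  shows "0 < bil (ch \<alpha>) (ch \<alpha>)"
proof (rule bil_pos)
  show "ch \<alpha> \<noteq> 0" using pr_coroot[OF assms] by (metis pr_simps(10) zero_neq_numeral)
qed

lemma bil_coroot_pos_iff:
  assumes "\<alpha> \<in> R"
  shows "0 < bil y (ch \<alpha>) \<longleftrightarrow> 0 < pr \<alpha> y"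
  unfolding bil_coroot[OF assms, of y]
  using bil_coroot_pos[OF assms] by (simp add: zero_less_mult_iff)

text \<open>Through the form, both \<open>v\<close> and \<open>ch \<gamma>\<close> represent
  multiples of the functional \<open>pr \<gamma>\<close>. Positive definiteness makes them
  proportional, and the value 2 makes them equal.\<close>

lemma coroot_unique:
  assumes "\<gamma> \<in> R" "pr \<gamma> v = 2" "\<And>y. bil y v = k * pr \<gamma> y"
  shows "ch \<gamma> = v"
proof -
  define k' where "k' = bil (ch \<gamma>) (ch \<gamma>) / 2"
  have k': "k' > 0" using bil_coroot_pos[OF assms(1)] by (simp add: k'_def)
  have 1: "bil y (ch \<gamma>) = k' * pr \<gamma> y" for y
    using bil_coroot[OF assms(1)] by (simp add: k'_def)
  have "bil y (k' *\<^sub>R v - k *\<^sub>R ch \<gamma>) = 0" for y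
    by (simp add: bil_simps 1 assms(3))
  then have eq: "k' *\<^sub>R v = k *\<^sub>R ch \<gamma>"
    using bil_pos[of "k' *\<^sub>R v - k *\<^sub>R ch \<gamma>"] by force
  have "k = k'" using arg_cong[OF eq, of "pr \<gamma>"] assms by simp
  with eq k' show ?thesis by simp
qed

text \<open>The axioms only say that a reflection preserves the set of coroots; that it respects the
  bijection with the roots follows from the characterisation of coroots by the form.\<close>

lemma coroot_sx:
  assumes "\<alpha> \<in> R" "\<beta> \<in> R"
  shows "ch (sx \<alpha> \<beta>) = sy \<alpha> (ch \<beta>)"
proof (rule coroot_unique)
  show "sx \<alpha> \<beta> \<in> R" using assms by (rule sx_in_R)
  show "pr (sx \<alpha> \<beta>) (sy \<alpha> (ch \<beta>)) = 2" using assms by (simp add: pr_sx_sy)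
  fix y
  have "bil y (sy \<alpha> (ch \<beta>)) = bil (sy \<alpha> y) (ch \<beta>)"
    using bil_invariant[OF assms(1), of "sy \<alpha> y" "ch \<beta>"] assms by simp
  then show "bil y (sy \<alpha> (ch \<beta>)) = bil (ch \<beta>) (ch \<beta>) / 2 * pr (sx \<alpha> \<beta>) y"
    by (simp add: bil_coroot[OF assms(2), of "sy \<alpha> y"] pr_sx)
qed

lemma linear_sy: "linear (sy \<alpha>)"
  by (rule linearI) (simp_all add: coroot_reflection_def scaleR_add_left scaleR_diff_right)

lemma sy_sx:
  assumes "\<alpha> \<in> R" "\<beta> \<in> R"
  shows "sy (sx \<alpha> \<beta>) (sy \<alpha> y) = sy \<alpha> (sy \<beta> y)"
proof -
  have "sy \<alpha> (sy \<beta> y) = sy \<alpha> y - pr \<beta> y *\<^sub>R sy \<alpha> (ch \<beta>)"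
    by (simp add: coroot_reflection_def[of D \<beta>] linear_diff[OF linear_sy] linear_scale[OF linear_sy])
  also have "\<dots> = sy (sx \<alpha> \<beta>) (sy \<alpha> y)"
    using assms by (simp add: coroot_reflection_def[of D "sx \<alpha> \<beta>"] coroot_sx pr_sx_sy)
  finally show ?thesis ..
qed

text \<open>Scaling a root by \<open>c\<close> scales its coroot by \<open>1 / c\<close>. Serves for
  positive roots proportional to a simple root and for passing to the negative of a root.\<close>

lemma sy_scale:
  assumes "\<beta> \<in> R" "c *\<^sub>R \<beta> \<in> R"
  shows "sy (c *\<^sub>R \<beta>) = sy \<beta>"
proof -
  have c: "c \<noteq> 0" using pr_coroot[OF assms(2)] by auto
  have bil: "bil y ((1 / c) *\<^sub>R ch \<beta>) = bil (ch \<beta>) (ch \<beta>) / (2 * c\<^sup>2) * pr (c *\<^sub>R \<beta>) y" for y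
  proof -
    have "bil y ((1 / c) *\<^sub>R ch \<beta>) = (1 / c) * (pr \<beta> y * bil (ch \<beta>) (ch \<beta>) / 2)"
      unfolding linear_scale[OF linear_bil] bil_coroot[OF assms(1), of y] real_scaleR_def ..
    then show ?thesis using c by (simp add: power2_eq_square mult_ac)
  qed
  have "ch (c *\<^sub>R \<beta>) = (1 / c) *\<^sub>R ch \<beta>"
    by (rule coroot_unique[OF assms(2) _ bil]) (simp add: c assms(1))
  then have "sy (c *\<^sub>R \<beta>) y = sy \<beta> y" for y
    unfolding coroot_reflection_def using c by simp
  then show ?thesis by (rule ext)
qed

subsection \<open>Positive roots and words in simple reflections\<close>

text \<open>Coefficients are natural numbers rather than merely nonnegative, so that the height,
  their sum, supports an induction.\<close>

definition pos_root :: "'x \<Rightarrow> bool" where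
  "pos_root \<beta> \<longleftrightarrow> \<beta> \<in> R \<and> (\<forall>\<alpha>\<in>S. pr \<beta> (om \<alpha>) \<in> \<nat>)"

lemma pos_root_simple: "\<alpha> \<in> S \<Longrightarrow> pos_root \<alpha>"
  by (simp add: pos_root_def S_R pr_fundamental_coweight)

lemma not_pos_root_le: "\<beta> \<in> R \<Longrightarrow> \<not> pos_root \<beta> \<Longrightarrow> \<alpha> \<in> S \<Longrightarrow> pr \<beta> (om \<alpha>) \<le> 0"
  using root_sign[of \<beta>] Nats_real_nonneg[of "- pr \<beta> (om \<alpha>)"] unfolding pos_root_def by auto

text \<open>A simple reflection permutes the positive roots not proportional to its simple root.\<close>

lemma pos_root_reflect:
  assumes "\<alpha> \<in> S" "pos_root \<beta>" "\<not> pos_root (sx \<alpha> \<beta>)"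
  shows "sy \<beta> = sy \<alpha>"
proof -
  have \<beta>: "\<beta> \<in> R" using assms by (simp add: pos_root_def)
  \<comment> \<open>Reflecting in \<alpha> changes only the coefficient at \<alpha>; any other
    coefficient is nonnegative for \<beta> and nonpositive for its image, hence zero.\<close>
  have "pr \<beta> (om \<gamma>) = 0" if "\<gamma> \<in> S - {\<alpha>}" for \<gamma>
  proof -
    have "pr (sx \<alpha> \<beta>) (om \<gamma>) = pr \<beta> (om \<gamma>)"
      using that assms by (auto simp: root_reflection_def pr_fundamental_coweight)
    moreover have "pr (sx \<alpha> \<beta>) (om \<gamma>) \<le> 0"
      using not_pos_root_le sx_in_R assms \<beta> S_R that by auto
    moreover have "0 \<le> pr \<beta> (om \<gamma>)" using assms that Nats_real_nonneg by (auto simp: pos_root_def)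
    ultimately show ?thesis by simp
  qed
  then have "(\<Sum>\<gamma>\<in>S. pr \<beta> (om \<gamma>) *\<^sub>R \<gamma>) = (\<Sum>\<gamma>\<in>S. if \<gamma> = \<alpha> then pr \<beta> (om \<alpha>) *\<^sub>R \<alpha> else 0)"
    by (intro sum.cong) auto
  then have "\<beta> = pr \<beta> (om \<alpha>) *\<^sub>R \<alpha>" using root_expansion[of \<beta>] assms(1) by simp
  then show ?thesis using sy_scale[of \<alpha> "pr \<beta> (om \<alpha>)"] \<beta> S_R assms by simp
qed

section \<open>Reflection subgroups as sets of words\<close>

text \<open>Reflections are involutions, so words without inverse letters already form the generated
  subgroup, and induction on words becomes available.\<close>

definition words :: "'x set \<Rightarrow> ('y \<Rightarrow> 'y) set" where
  "words J = {foldr sy \<beta>s | \<beta>s. set \<beta>s \<subseteq> J}"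

lemma words_id: "id \<in> words J"
  unfolding words_def by (auto intro!: exI[of _ "[]"])

lemma words_refl: "\<alpha> \<in> J \<Longrightarrow> sy \<alpha> \<in> words J"
  unfolding words_def by (auto intro!: exI[of _ "[\<alpha>]"])

lemma words_comp:
  assumes "f \<in> words J" "g \<in> words J"
  shows "f \<circ> g \<in> words J"
proof -
  obtain as bs where "f = foldr sy as" "g = foldr sy bs" "set as \<subseteq> J" "set bs \<subseteq> J"
    using assms by (auto simp: words_def)
  then show ?thesis unfolding words_def by (auto intro!: exI[of _ "as @ bs"])
qed

lemma words_mono: "I \<subseteq> J \<Longrightarrow> words I \<subseteq> words J"
  unfolding words_def by blast

lemma foldr_sy_rev: "set \<beta>s \<subseteq> R \<Longrightarrow> foldr sy (rev \<beta>s) (foldr sy \<beta>s y) = y"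
  by (induction \<beta>s arbitrary: y) auto

lemma words_inverse:
  assumes "J \<subseteq> R" "f \<in> words J"
  obtains g where "g \<in> words J" "\<And>y. f (g y) = y" "\<And>y. g (f y) = y"
proof -
  obtain as where as: "f = foldr sy as" "set as \<subseteq> J" using assms by (auto simp: words_def)
  show ?thesis
  proof
    show "foldr sy (rev as) \<in> words J" using as by (auto simp: words_def intro!: exI[of _ "rev as"])
    have "set as \<subseteq> R" using as(2) assms(1) by (rule subset_trans)
    then show "foldr sy (rev as) (f y) = y" "f (foldr sy (rev as) y) = y" for y
      using foldr_sy_rev[of as y] foldr_sy_rev[of "rev as" y] by (simp_all add: as(1))
  qed
qed

text \<open>Induction on the height of a positive root \<beta>: some simple \<alpha> lowers the
  height, and the reflection in \<beta> is the conjugate by \<open>sy \<alpha>\<close> of the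
  reflection in the lower root.\<close>

lemma reflection_in_words:
  assumes "\<beta> \<in> R"
  shows "sy \<beta> \<in> words S"
proof -
  have pos: "sy \<beta> \<in> words S" if "pos_root \<beta>" "(\<Sum>\<alpha>\<in>S. pr \<beta> (om \<alpha>)) = of_nat n" for \<beta> n
    using that
  proof (induction n arbitrary: \<beta> rule: less_induct)
    case (less n)
    have \<beta>: "\<beta> \<in> R" using less by (simp add: pos_root_def)
    have "0 < pr \<beta> (ch \<beta>)" using \<beta> by simp
    also have "pr \<beta> (ch \<beta>) = (\<Sum>\<alpha>\<in>S. pr \<beta> (om \<alpha>) * pr \<alpha> (ch \<beta>))"
      using arg_cong[OF root_expansion[of \<beta>], of "\<lambda>x. pr x (ch \<beta>)"]
      unfolding linear_sum[OF linear_pr(1)] linear_scale[OF linear_pr(1)] real_scaleR_def .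
    finally obtain \<alpha> where \<alpha>: "\<alpha> \<in> S" "0 < pr \<beta> (om \<alpha>) * pr \<alpha> (ch \<beta>)"
      using sum_pos_term by blast
    then have "0 < pr \<alpha> (ch \<beta>)"
      using less(2) Nats_real_nonneg[of "pr \<beta> (om \<alpha>)"] by (auto simp: pos_root_def zero_less_mult_iff)
    \<comment> \<open>The pairings of \<alpha> with \<open>ch \<beta>\<close> and of \<beta> with
      \<open>ch \<alpha>\<close> both have the sign of the symmetric form on the two
      coroots.\<close>
    then have "0 < bil (ch \<beta>) (ch \<alpha>)"
      using bil_coroot_pos_iff[OF S_R[OF \<alpha>(1)]] by blast
    then have p: "0 < pr \<beta> (ch \<alpha>)"
      using bil_coroot_pos_iff[OF \<beta>] by (metis bil_commute)
    show ?case
    proof (cases "pos_root (sx \<alpha> \<beta>)")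
      case False
      then have "sy \<beta> = sy \<alpha>" by (rule pos_root_reflect[OF \<alpha>(1) less(2)])
      then show ?thesis using words_refl[OF \<alpha>(1)] by simp
    next
      case True
      have "(\<Sum>\<gamma>\<in>S. pr (sx \<alpha> \<beta>) (om \<gamma>)) \<in> \<nat>"
        using True by (intro sum_Nats) (simp add: pos_root_def)
      then obtain m where m: "(\<Sum>\<gamma>\<in>S. pr (sx \<alpha> \<beta>) (om \<gamma>)) = of_nat m"
        by (auto simp: Nats_def)
      \<comment> \<open>A simple root has height 1, so the reflection lowers the height of \<beta>
        by exactly \<open>pr \<beta> (ch \<alpha>)\<close>.\<close>
      have "(\<Sum>\<gamma>\<in>S. pr \<alpha> (om \<gamma>)) = (\<Sum>\<gamma>\<in>S. if \<gamma> = \<alpha> then 1 else 0)"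
        using \<alpha> by (intro sum.cong) (auto simp: pr_fundamental_coweight)
      then have "(\<Sum>\<gamma>\<in>S. pr (sx \<alpha> \<beta>) (om \<gamma>)) = of_nat n - pr \<beta> (ch \<alpha>)"
        using \<alpha> less(3)
        by (simp add: root_reflection_def sum_subtractf sum_distrib_left[symmetric])
      then have "m < n" using m p by linarith
      then have "sy (sx \<alpha> \<beta>) \<in> words S" using less.IH True m by blast
      then have "sy \<alpha> \<circ> sy (sx \<alpha> \<beta>) \<circ> sy \<alpha> \<in> words S"
        using words_comp words_refl \<alpha> by blast
      also have "sy \<alpha> \<circ> sy (sx \<alpha> \<beta>) \<circ> sy \<alpha> = sy \<beta>"
        using \<alpha> \<beta> S_R by (simp add: fun_eq_iff sy_sx)
      finally show ?thesis .
    qed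
  qed
  have pos': "sy \<beta> \<in> words S" if "pos_root \<beta>" for \<beta>
  proof -
    have "(\<Sum>\<alpha>\<in>S. pr \<beta> (om \<alpha>)) \<in> \<nat>"
      using that by (intro sum_Nats) (simp add: pos_root_def)
    then show ?thesis using pos[OF that] by (auto simp: Nats_def)
  qed
  show ?thesis
  proof (cases "pos_root \<beta>")
    case False
    have "sx \<beta> \<beta> = (-1) *\<^sub>R \<beta>" using assms by (simp add: root_reflection_def scaleR_2)
    then have neg: "(-1) *\<^sub>R \<beta> \<in> R" using sx_in_R[OF assms assms] by simp
    then have "pos_root ((-1) *\<^sub>R \<beta>)"
      using root_sign[OF assms] False assms by (auto simp: pos_root_def)
    then show ?thesis using pos'[of "(-1) *\<^sub>R \<beta>"] unfolding sy_scale[OF assms neg] by blast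
  qed (rule pos')
qed

lemma words_R: "words R = words S"
proof
  show "words R \<subseteq> words S"
  proof
    fix f assume "f \<in> words R"
    then obtain as where as: "f = foldr sy as" "set as \<subseteq> R" by (auto simp: words_def)
    from as(2) have "foldr sy as \<in> words S"
      by (induction as) (auto intro!: words_comp reflection_in_words simp: words_id)
    then show "f \<in> words S" using as by simp
  qed
qed (auto intro!: words_mono simp: S_R subset_iff[of S R])

section \<open>Deletion and the stabiliser of a fundamental coweight\<close>

lemma foldr_sx_in_R: "set as \<subseteq> R \<Longrightarrow> \<beta> \<in> R \<Longrightarrow> foldr sx as \<beta> \<in> R"
  by (induction as) (auto intro: sx_in_R)

lemma pr_foldr: "set as \<subseteq> R \<Longrightarrow> pr (foldr sx as x) (foldr sy as y) = pr x y"
  by (induction as) (auto simp: pr_sx_sy)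

lemma sy_foldr:
  "set as \<subseteq> R \<Longrightarrow> \<beta> \<in> R \<Longrightarrow> sy (foldr sx as \<beta>) (foldr sy as y) = foldr sy as (sy \<beta> y)"
  by (induction as) (auto simp: sy_sx foldr_sx_in_R)

text \<open>Apply the letters of \<open>as\<close> to the positive root \<alpha>, from the right. At
  the letter \<open>b\<close> where it stops being positive, the current root has the same
  reflection as \<open>b\<close>, so \<open>b\<close> cancels against the final \<alpha>.\<close>

lemma deletion:
  assumes "set as \<subseteq> S" "\<alpha> \<in> S" "\<not> pos_root (foldr sx as \<alpha>)"
  shows "\<exists>bs. set bs \<subseteq> S \<and> length bs < length as \<and> foldr sy bs = foldr sy (as @ [\<alpha>])"
  using assms(1,3)
proof (induction as)
  case Nil
  then show ?case using assms(2) pos_root_simple by simp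
next
  case (Cons b as)
  have R: "b \<in> R" "set as \<subseteq> R" "\<alpha> \<in> R" using Cons assms(2) S_R by auto
  show ?case
  proof (cases "pos_root (foldr sx as \<alpha>)")
    case True
    then have "sy (foldr sx as \<alpha>) = sy b" using pos_root_reflect Cons(2,3) by simp
    then have "foldr sy as (sy \<alpha> y) = sy b (foldr sy as y)" for y
      using sy_foldr[OF R(2,3), of y] by simp
    then have "foldr sy as = foldr sy ((b # as) @ [\<alpha>])"
      using R(1) by (simp add: fun_eq_iff)
    moreover have "set as \<subseteq> S" "length as < length (b # as)" using Cons(2) by auto
    ultimately show ?thesis by blast
  next
    case False
    moreover have "set as \<subseteq> S" using Cons(2) by simp
    ultimately obtain bs where
      "set bs \<subseteq> S" "length bs < length as" "foldr sy bs = foldr sy (as @ [\<alpha>])"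
      using Cons.IH by blast
    then show ?thesis using Cons(2) by (intro exI[of _ "b # bs"]) simp
  qed
qed

text \<open>Induction on the length of a word for \<open>f\<close>. If \<open>deletion\<close>
  applies to the last letter, the word gets shorter; otherwise the last letter differs from
  \<alpha>, so it fixes the coweight and can be split off.\<close>

lemma stabilizer_coweight:
  assumes "\<alpha> \<in> S" "f \<in> words S" "f (om \<alpha>) = om \<alpha>"
  shows "f \<in> words (S - {\<alpha>})"
proof -
  have "foldr sy as \<in> words (S - {\<alpha>})" if "set as \<subseteq> S" "foldr sy as (om \<alpha>) = om \<alpha>" for as
    using that
  proof (induction "length as" arbitrary: as rule: less_induct)
    case less
    show ?case
    proof (cases as rule: rev_exhaust)
      case Nil
      then show ?thesis using words_id by (simp add: id_def)
    next
      case (snoc bs \<beta>)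
      have S: "set bs \<subseteq> S" "\<beta> \<in> S" and R: "set bs \<subseteq> R" "\<beta> \<in> R"
        using less snoc S_R by auto
      show ?thesis
      proof (cases "pos_root (foldr sx bs \<beta>)")
        case False
        then obtain cs where "set cs \<subseteq> S" "length cs < length bs" "foldr sy cs = foldr sy as"
          using deletion[OF S] snoc by metis
        then show ?thesis using less(1)[of cs] less(3) snoc by simp
      next
        case True
        \<comment> \<open>Moving the prefix \<open>bs\<close> across the pairing turns positivity
          into \<open>0 \<le> - pr \<beta> (om \<alpha>)\<close>, which fails for the letter
          \<alpha> itself.\<close>
        have "0 \<le> pr (foldr sx bs \<beta>) (om \<alpha>)"
          using True assms(1) Nats_real_nonneg by (auto simp: pos_root_def)
        also have "om \<alpha> = foldr sy bs (sy \<beta> (om \<alpha>))" using less(3) snoc by simp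
        also have "pr (foldr sx bs \<beta>) \<dots> = pr \<beta> (sy \<beta> (om \<alpha>))" by (rule pr_foldr[OF R(1)])
        also have "\<dots> = - pr \<beta> (om \<alpha>)" using R by (simp add: coroot_reflection_def)
        finally have "\<beta> \<noteq> \<alpha>" using pr_fundamental_coweight assms(1) by auto
        then have "sy \<beta> (om \<alpha>) = om \<alpha>"
          using S assms(1) by (simp add: coroot_reflection_def pr_fundamental_coweight)
        then have "foldr sy bs \<in> words (S - {\<alpha>})" using less snoc S by simp
        moreover have "sy \<beta> \<in> words (S - {\<alpha>})" using S \<open>\<beta> \<noteq> \<alpha>\<close> by (intro words_refl) simp
        ultimately have "foldr sy bs \<circ> sy \<beta> \<in> words (S - {\<alpha>})" by (rule words_comp)
        also have "foldr sy bs \<circ> sy \<beta> = foldr sy as" using snoc by (simp add: fun_eq_iff)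
        finally show ?thesis .
      qed
    qed
  qed
  then show ?thesis using assms by (auto simp: words_def)
qed

lemma words_fix_coweight:
  assumes "\<alpha> \<in> S" "f \<in> words (S - {\<alpha>})"
  shows "f (om \<alpha>) = om \<alpha>"
proof -
  obtain as where as: "f = foldr sy as" "set as \<subseteq> S - {\<alpha>}" using assms by (auto simp: words_def)
  from as(2) have "foldr sy as (om \<alpha>) = om \<alpha>"
    using assms(1) by (induction as) (auto simp: coroot_reflection_def pr_fundamental_coweight)
  then show ?thesis using as by simp
qed

subsection \<open>Coefficients with respect to the simple coroots\<close>

text \<open>This is the fundamental weight at \<alpha> as a functional: the form identifies
  \<open>om \<alpha>\<close> with a positive multiple of it.\<close>

definition coef :: "'x \<Rightarrow> 'y \<Rightarrow> real" where
  "coef \<alpha> y = 2 * bil (om \<alpha>) y / bil (ch \<alpha>) (ch \<alpha>)"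

lemma linear_coef: "linear (coef \<alpha>)"
  unfolding coef_def by (rule linearI) (simp_all add: bil_simps algebra_simps add_divide_distrib)

lemmas coef_simps =
  linear_diff[OF linear_coef] linear_scale[OF linear_coef] linear_0[OF linear_coef]

lemma coef_coroot:
  assumes "\<alpha> \<in> S" "\<beta> \<in> S"
  shows "coef \<alpha> (ch \<beta>) = (if \<beta> = \<alpha> then 1 else 0)"
  using assms bil_coroot[of \<beta> "om \<alpha>"] bil_coroot_pos[of \<alpha>]
  by (auto simp: coef_def S_R pr_fundamental_coweight)

text \<open>The difference of the two sides is orthogonal to all fundamental coweights. These span,
  so it is orthogonal to itself and vanishes.\<close>

lemma coroot_expansion: "y = (\<Sum>\<alpha>\<in>S. coef \<alpha> y *\<^sub>R ch \<alpha>)"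
proof -
  define z where "z = y - (\<Sum>\<alpha>\<in>S. coef \<alpha> y *\<^sub>R ch \<alpha>)"
  have "bil (om \<beta>) z = 0" if \<beta>: "\<beta> \<in> S" for \<beta>
  proof -
    have "coef \<beta> (\<Sum>\<alpha>\<in>S. coef \<alpha> y *\<^sub>R ch \<alpha>) = (\<Sum>\<alpha>\<in>S. if \<alpha> = \<beta> then coef \<alpha> y else 0)"
      using \<beta>
      by (simp add: linear_sum[OF linear_coef] coef_simps coef_coroot if_distrib cong: if_cong)
    then have "coef \<beta> z = 0" using \<beta> by (simp add: z_def coef_simps)
    then show ?thesis using bil_coroot_pos[of \<beta>] \<beta> S_R by (auto simp: coef_def)
  qed
  then have "bil z z = 0"
    by (subst coweight_expansion[of z])
      (simp add: linear_sum[OF linear_bil_left] bil_simps)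
  then show ?thesis using bil_pos[of z] by (auto simp: z_def)
qed

lemma coef_sy:
  assumes "\<alpha> \<in> S" "\<beta> \<in> S"
  shows "coef \<alpha> (sy \<beta> y) = coef \<alpha> y - (if \<beta> = \<alpha> then pr \<alpha> y else 0)"
  using assms by (auto simp: coroot_reflection_def coef_simps coef_coroot)

text \<open>A simple reflection changes only its own coefficient, so the coefficient at \<alpha> is
  constant on the orbits of the maximal parabolic subgroup omitting \<alpha>.\<close>

lemma coef_words:
  assumes "\<alpha> \<in> S" "f \<in> words (S - {\<alpha>})"
  shows "coef \<alpha> (f y) = coef \<alpha> y"
proof -
  obtain as where as: "f = foldr sy as" "set as \<subseteq> S - {\<alpha>}" using assms by (auto simp: words_def)
  from as(2) have "coef \<alpha> (foldr sy as y) = coef \<alpha> y"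
    using assms(1) by (induction as) (auto simp: coef_sy)
  then show ?thesis using as by simp
qed

section \<open>Integrality and orbits of a cominuscule coweight\<close>

text \<open>Moving the word to the root side leaves a coefficient of another root \<gamma>, which is
  an integer and in the cominuscule case at most 1 in absolute value.\<close>

lemma pr_coweight_Ints:
  assumes "\<alpha> \<in> S" "\<beta> \<in> R" "f \<in> words R"
  shows "pr \<beta> (f (om \<alpha>)) \<in> \<int>"
    and "cominuscule D \<alpha> \<Longrightarrow> \<bar>pr \<beta> (f (om \<alpha>))\<bar> \<le> 1"
proof -
  obtain as where as: "f = foldr sy as" "set as \<subseteq> R" using assms by (auto simp: words_def)
  define \<gamma> where "\<gamma> = foldr sx (rev as) \<beta>"
  have \<gamma>: "\<gamma> \<in> R" unfolding \<gamma>_def using as assms by (intro foldr_sx_in_R) auto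
  have eq: "pr \<beta> (f (om \<alpha>)) = pr \<gamma> (om \<alpha>)"
    using pr_foldr[of "rev as" \<beta> "f (om \<alpha>)"] foldr_sy_rev[of as "om \<alpha>"] as by (simp add: \<gamma>_def)
  show "pr \<beta> (f (om \<alpha>)) \<in> \<int>"
    using root_sign[OF \<gamma>] assms(1) Nats_subset_Ints unfolding eq
    by (metis Ints_minus minus_minus subsetD)
  show "\<bar>pr \<beta> (f (om \<alpha>))\<bar> \<le> 1" if "cominuscule D \<alpha>"
  proof -
    have "the_inv_into R ch (ch \<gamma>) = \<gamma>" using \<gamma> by (simp add: the_inv_into_f_f inj_coroot)
    then show ?thesis using that \<gamma> unfolding eq
      by (auto simp: cominuscule_def minuscule_def dual_datum_def fundamental_coweight_def)
  qed
qed

text \<open>Each letter subtracts an integer multiple of a simple coroot, so the difference has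
  integer coefficients even when those of \<open>om \<alpha>\<close> are fractional.\<close>

lemma coef_coweight_Ints:
  assumes "\<alpha> \<in> S" "\<beta> \<in> S" "f \<in> words S"
  shows "coef \<beta> (om \<alpha> - f (om \<alpha>)) \<in> \<int>"
proof -
  obtain as where as: "f = foldr sy as" "set as \<subseteq> S" using assms by (auto simp: words_def)
  from as(2) have "coef \<beta> (om \<alpha> - foldr sy as (om \<alpha>)) \<in> \<int>"
  proof (induction as)
    case (Cons a as)
    have "foldr sy as \<in> words R" using Cons(2) S_R by (auto simp: words_def)
    then have "pr \<beta> (foldr sy as (om \<alpha>)) \<in> \<int>" using pr_coweight_Ints assms S_R by blast
    then have "coef \<beta> (om \<alpha> - foldr sy as (om \<alpha>)) + pr \<beta> (foldr sy as (om \<alpha>)) \<in> \<int>"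
      using Cons by auto
    then show ?case using Cons assms by (auto simp: coef_sy coef_simps algebra_simps)
  qed (simp add: coef_simps)
  then show ?thesis using as by simp
qed

lemma sum_abs_coef_less:
  assumes "\<beta> \<in> S" "\<And>\<gamma>. \<gamma> \<in> S \<Longrightarrow> \<gamma> \<noteq> \<beta> \<Longrightarrow> coef \<gamma> y' = coef \<gamma> y"
    and "\<bar>coef \<beta> y'\<bar> < \<bar>coef \<beta> y\<bar>"
  shows "(\<Sum>\<gamma>\<in>S. \<bar>coef \<gamma> y'\<bar>) < (\<Sum>\<gamma>\<in>S. \<bar>coef \<gamma> y\<bar>)"
proof (rule sum_strict_mono_ex1)
  have "\<bar>coef \<gamma> y'\<bar> \<le> \<bar>coef \<gamma> y\<bar>" if "\<gamma> \<in> S" for \<gamma>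
    using assms(2)[OF that] assms(3) by (cases "\<gamma> = \<beta>") auto
  then show "\<forall>\<gamma>\<in>S. \<bar>coef \<gamma> y'\<bar> \<le> \<bar>coef \<gamma> y\<bar>" by blast
  show "\<exists>\<gamma>\<in>S. \<bar>coef \<gamma> y'\<bar> < \<bar>coef \<gamma> y\<bar>" using assms(1,3) by blast
qed (rule finite_S)

text \<open>The minimality argument is run as strong induction on the measure \<open>h\<close>,
  which is a natural number because the coefficients of the difference are integers.\<close>

lemma cominuscule_orbits:
  assumes "\<alpha> \<in> S" "cominuscule D \<alpha>" "\<mu> \<in> S" "f \<in> words S" "g \<in> words S"
    and "coef \<mu> (f (om \<alpha>)) = coef \<mu> (g (om \<alpha>))"
  shows "\<exists>a\<in>words (S - {\<mu>}). \<exists>b\<in>words (S - {\<mu>}). a (f (om \<alpha>)) = b (g (om \<alpha>))"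
proof -
  define h where "h f g = (\<Sum>\<beta>\<in>S. \<bar>coef \<beta> (f (om \<alpha>) - g (om \<alpha>))\<bar>)" for f g :: "'y \<Rightarrow> 'y"
  have int: "coef \<beta> (f (om \<alpha>) - g (om \<alpha>)) \<in> \<int>" if "f \<in> words S" "g \<in> words S" "\<beta> \<in> S" for f g \<beta>
    using Ints_diff[OF coef_coweight_Ints[OF assms(1) that(3,2)] coef_coweight_Ints[OF assms(1) that(3,1)]]
    by (simp add: coef_simps)
  have hNats: "h f g \<in> \<nat>" if "f \<in> words S" "g \<in> words S" for f g
    unfolding h_def using int[OF that] by (intro sum_Nats) (simp add: Nats_altdef2)
  have main: "\<exists>a\<in>words (S - {\<mu>}). \<exists>b\<in>words (S - {\<mu>}). a (f (om \<alpha>)) = b (g (om \<alpha>))"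
    if "h f g = of_nat n" "f \<in> words S" "g \<in> words S"
    "coef \<mu> (f (om \<alpha>)) = coef \<mu> (g (om \<alpha>))" for n f g
    using that
  proof (induction n arbitrary: f g rule: less_induct)
    case (less n)
    define u v d where "u = f (om \<alpha>)" and "v = g (om \<alpha>)" and "d = u - v"
    show ?case
    proof (cases "d = 0")
      case True
      then show ?thesis
        by (intro bexI[of _ id] words_id) (simp add: u_def v_def d_def)
    next
      case False
      then have "0 < bil d d" by (rule bil_pos)
      \<comment> \<open>Expanding one argument of the form in simple coroots leaves a sum with a
        positive term, which supplies \<beta>.\<close>
      also have "bil d d = (\<Sum>\<beta>\<in>S. coef \<beta> d * (pr \<beta> d * bil (ch \<beta>) (ch \<beta>) / 2))"
        by (subst (2) coroot_expansion[of d])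
          (simp add: linear_sum[OF linear_bil] bil_simps bil_coroot[OF S_R, of _ d] cong: sum.cong)
      finally obtain \<beta> where \<beta>: "\<beta> \<in> S" "0 < coef \<beta> d * (pr \<beta> d * bil (ch \<beta>) (ch \<beta>) / 2)"
        using sum_pos_term by blast
      then have sgn: "0 < coef \<beta> d * pr \<beta> d"
        using bil_coroot_pos[OF S_R[OF \<beta>(1)]] by (simp add: zero_less_mult_iff mult_less_0_iff)
      \<comment> \<open>The equal coefficients at \<mu> exclude \<open>\<beta> = \<mu>\<close>, so
        the reflection in \<beta> stays in the allowed parabolic subgroup.\<close>
      have "coef \<mu> d = 0" using less by (simp add: d_def u_def v_def coef_simps)
      then have \<mu>: "\<beta> \<in> S - {\<mu>}" using sgn \<beta> by auto
      have W: "f \<in> words R" "g \<in> words R" using less words_R by auto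
      have r: "sy \<beta> \<in> words S" "sy \<beta> \<in> words (S - {\<mu>})" using \<beta> \<mu> words_refl by auto
      have "pr \<beta> u \<in> \<int>" "\<bar>pr \<beta> u\<bar> \<le> 1" "pr \<beta> v \<in> \<int>" "\<bar>pr \<beta> v\<bar> \<le> 1"
        using pr_coweight_Ints[OF assms(1) S_R[OF \<beta>(1)]] W assms(2) by (auto simp: u_def v_def)
      then obtain x y where xy: "pr \<beta> u = of_int x" "\<bar>x\<bar> \<le> 1" "pr \<beta> v = of_int y" "\<bar>y\<bar> \<le> 1"
        by (auto simp: Ints_def)
      have "coef \<beta> d \<in> \<int>" using int less \<beta> by (simp add: d_def u_def v_def)
      then obtain k where k: "coef \<beta> d = of_int k" by (auto simp: Ints_def)
      have "0 < real_of_int (k * (x - y))" using sgn k xy by (simp add: d_def)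
      then have "0 < k * (x - y)" by linarith
      \<comment> \<open>Either \<open>x\<close> has the sign of \<open>k\<close>, or
        \<open>y\<close> has the opposite sign; being of absolute value 1, it moves \<open>k\<close>
        one step towards 0 when \<open>f\<close> or \<open>g\<close>, respectively, is
        reflected.\<close>
      then have "0 < k * x \<or> k * y < 0" by (auto simp: algebra_simps)
      moreover have "\<bar>k - x\<bar> < \<bar>k\<bar>" if "0 < k * x"
        using that xy by (auto simp: zero_less_mult_iff)
      moreover have "\<bar>k + y\<bar> < \<bar>k\<bar>" if "k * y < 0"
        using that xy by (auto simp: mult_less_0_iff)
      ultimately consider "\<bar>k - x\<bar> < \<bar>k\<bar>" | "\<bar>k + y\<bar> < \<bar>k\<bar>" by blast
      then show ?thesis
      proof cases
        case 1
        have "h (sy \<beta> \<circ> f) g < h f g" unfolding h_def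
        proof (rule sum_abs_coef_less[OF \<beta>(1)])
          show "coef \<gamma> ((sy \<beta> \<circ> f) (om \<alpha>) - g (om \<alpha>)) = coef \<gamma> (f (om \<alpha>) - g (om \<alpha>))"
            if "\<gamma> \<in> S" "\<gamma> \<noteq> \<beta>" for \<gamma>
            using that by (simp add: coef_sy[OF that(1) \<beta>(1)] coef_simps)
          have "coef \<beta> ((sy \<beta> \<circ> f) (om \<alpha>) - g (om \<alpha>)) = of_int (k - x)"
            using k xy(1) by (simp add: coef_sy[OF \<beta>(1) \<beta>(1)] coef_simps d_def u_def v_def)
          moreover have "coef \<beta> (f (om \<alpha>) - g (om \<alpha>)) = of_int k"
            using k by (simp add: d_def u_def v_def)
          ultimately show "\<bar>coef \<beta> ((sy \<beta> \<circ> f) (om \<alpha>) - g (om \<alpha>))\<bar> < \<bar>coef \<beta> (f (om \<alpha>) - g (om \<alpha>))\<bar>"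
            using 1 by linarith
        qed
        moreover obtain m where m: "h (sy \<beta> \<circ> f) g = of_nat m"
          using hNats[OF words_comp[OF r(1) less(3)] less(4)] by (auto simp: Nats_def)
        ultimately have "m < n" using less by simp
        moreover have "coef \<mu> ((sy \<beta> \<circ> f) (om \<alpha>)) = coef \<mu> (g (om \<alpha>))"
          using \<mu> less assms(3) by (simp add: coef_sy)
        ultimately obtain a b where "a \<in> words (S - {\<mu>})" "b \<in> words (S - {\<mu>})"
          "a ((sy \<beta> \<circ> f) (om \<alpha>)) = b (g (om \<alpha>))"
          using less.IH[OF _ m words_comp[OF r(1) less(3)] less(4)] by blast
        then show ?thesis using words_comp[OF _ r(2)]
          by (intro bexI[of _ "a \<circ> sy \<beta>"] bexI[of _ b]) auto
      next
        case 2
        have "h f (sy \<beta> \<circ> g) < h f g" unfolding h_def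
        proof (rule sum_abs_coef_less[OF \<beta>(1)])
          show "coef \<gamma> (f (om \<alpha>) - (sy \<beta> \<circ> g) (om \<alpha>)) = coef \<gamma> (f (om \<alpha>) - g (om \<alpha>))"
            if "\<gamma> \<in> S" "\<gamma> \<noteq> \<beta>" for \<gamma>
            using that by (simp add: coef_sy[OF that(1) \<beta>(1)] coef_simps)
          have "coef \<beta> (f (om \<alpha>) - (sy \<beta> \<circ> g) (om \<alpha>)) = of_int (k + y)"
            using k xy(3) by (simp add: coef_sy[OF \<beta>(1) \<beta>(1)] coef_simps d_def u_def v_def)
          moreover have "coef \<beta> (f (om \<alpha>) - g (om \<alpha>)) = of_int k"
            using k by (simp add: d_def u_def v_def)
          ultimately show "\<bar>coef \<beta> (f (om \<alpha>) - (sy \<beta> \<circ> g) (om \<alpha>))\<bar> < \<bar>coef \<beta> (f (om \<alpha>) - g (om \<alpha>))\<bar>"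
            using 2 by linarith
        qed
        moreover obtain m where m: "h f (sy \<beta> \<circ> g) = of_nat m"
          using hNats[OF less(3) words_comp[OF r(1) less(4)]] by (auto simp: Nats_def)
        ultimately have "m < n" using less by simp
        moreover have "coef \<mu> (f (om \<alpha>)) = coef \<mu> ((sy \<beta> \<circ> g) (om \<alpha>))"
          using \<mu> less assms(3) by (simp add: coef_sy)
        ultimately obtain a b where "a \<in> words (S - {\<mu>})" "b \<in> words (S - {\<mu>})"
          "a (f (om \<alpha>)) = b ((sy \<beta> \<circ> g) (om \<alpha>))"
          using less.IH[OF _ m less(3) words_comp[OF r(1) less(4)]] by blast
        then show ?thesis using words_comp[OF _ r(2)]
          by (intro bexI[of _ a] bexI[of _ "b \<circ> sy \<beta>"]) auto
      qed
    qed
  qed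
  obtain n where "h f g = of_nat n" using hNats[OF assms(4,5)] by (auto simp: Nats_def)
  then show ?thesis using main assms(4-6) by blast
qed

subsection \<open>The Weyl group and its double cosets\<close>

lemma sy_Bij: "\<alpha> \<in> R \<Longrightarrow> sy \<alpha> \<in> carrier (BijGroup UNIV)"
  by (auto simp: BijGroup_def Bij_def intro!: o_bij[of "sy \<alpha>"])

text \<open>Stated for any group multiplied by composition, to serve both for all reflections in
  \<open>BijGroup UNIV\<close> and for the parabolic subgroups of
  \<open>weyl_group D\<close>.\<close>

lemma generate_words:
  assumes "group G" "J \<subseteq> R" "sy ` J \<subseteq> carrier G" "\<one>\<^bsub>G\<^esub> = id"
    and "\<And>f g. f \<in> carrier G \<Longrightarrow> g \<in> carrier G \<Longrightarrow> f \<otimes>\<^bsub>G\<^esub> g = f \<circ> g"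
  shows "generate G (sy ` J) = words J"
proof
  interpret group G by fact
  have invol: "inv\<^bsub>G\<^esub> (sy \<alpha>) = sy \<alpha>" if "\<alpha> \<in> J" for \<alpha>
  proof (rule inv_equality)
    show "sy \<alpha> \<otimes>\<^bsub>G\<^esub> sy \<alpha> = \<one>\<^bsub>G\<^esub>" using that assms by (auto simp: fun_eq_iff subset_iff)
  qed (use that assms in auto)
  show "generate G (sy ` J) \<subseteq> words J"
  proof
    fix f assume "f \<in> generate G (sy ` J)"
    then show "f \<in> words J"
    proof (induction rule: generate.induct)
      case (eng f g)
      then show ?case using words_comp assms(5) generate_in_carrier[OF assms(3)] by metis
    next
      case one
      then show ?case using words_id assms(4) by metis
    next
      case (incl f)
      then show ?case using words_refl by blast
    next
      case (inv f)
      then show ?case using words_refl invol by auto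
    qed
  qed
  show "words J \<subseteq> generate G (sy ` J)"
  proof
    fix f assume "f \<in> words J"
    then obtain as where as: "f = foldr sy as" "set as \<subseteq> J" by (auto simp: words_def)
    from as(2) have "foldr sy as \<in> generate G (sy ` J)"
    proof (induction as)
      case Nil
      then show ?case using generate.one[of G "sy ` J"] assms(4) by (simp add: id_def)
    next
      case (Cons a as)
      then have a: "sy a \<in> generate G (sy ` J)" "foldr sy as \<in> generate G (sy ` J)"
        by (auto intro: generate.incl)
      then have "sy a \<otimes>\<^bsub>G\<^esub> foldr sy as = sy a \<circ> foldr sy as"
        using assms(5) generate_in_carrier[OF assms(3)] by auto
      then show ?case using generate.eng[OF a] by (simp add: comp_def)
    qed
    then show "f \<in> generate G (sy ` J)" using as by simp
  qed
qed

lemma group_weyl_group: "group (weyl_group D)"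
  unfolding weyl_group_def by (intro group.group_subgroup_generated group_BijGroup)

lemma weyl_one: "\<one>\<^bsub>weyl_group D\<^esub> = id"
  by (simp add: weyl_group_def BijGroup_def id_def restrict_UNIV)

lemma carrier_weyl_group: "carrier (weyl_group D) = words S"
proof -
  have "carrier (weyl_group D) = generate (BijGroup UNIV) (sy ` R)"
    unfolding weyl_group_def carrier_subgroup_generated
    using sy_Bij by (intro arg_cong[where f = "generate _"]) auto
  also have "\<dots> = words R"
  proof (rule generate_words[OF group_BijGroup])
    show "sy ` R \<subseteq> carrier (BijGroup UNIV)" using sy_Bij by blast
  qed (auto simp: BijGroup_def compose_def id_def restrict_UNIV)
  finally show ?thesis using words_R by simp
qed

lemma weyl_mult:
  assumes "f \<in> carrier (weyl_group D)" "g \<in> carrier (weyl_group D)"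
  shows "f \<otimes>\<^bsub>weyl_group D\<^esub> g = f \<circ> g"
proof -
  have "carrier (weyl_group D) \<subseteq> carrier (BijGroup UNIV)"
    unfolding weyl_group_def by (intro group.carrier_subgroup_generated_subset group_BijGroup)
  then show ?thesis using assms
    by (auto simp: weyl_group_def BijGroup_def compose_def restrict_UNIV fun_eq_iff)
qed

lemma parabolic_words:
  assumes "J \<subseteq> S"
  shows "parabolic_weyl_group D J = words J"
  unfolding parabolic_weyl_group_def
proof (rule generate_words)
  show "sy ` J \<subseteq> carrier (weyl_group D)"
    using assms carrier_weyl_group words_refl by blast
qed (use assms S_R group_weyl_group weyl_one weyl_mult in auto)

lemma weyl_inv:
  assumes "w \<in> words S"
  shows "inv\<^bsub>weyl_group D\<^esub> w \<in> words S" "w ((inv\<^bsub>weyl_group D\<^esub> w) y) = y"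
    "(inv\<^bsub>weyl_group D\<^esub> w) (w y) = y"
proof -
  interpret group "weyl_group D" by (rule group_weyl_group)
  have w: "w \<in> carrier (weyl_group D)" using assms carrier_weyl_group by simp
  then show "inv\<^bsub>weyl_group D\<^esub> w \<in> words S" using carrier_weyl_group by auto
  show "w ((inv\<^bsub>weyl_group D\<^esub> w) y) = y"
    using r_inv[OF w] weyl_mult[OF w inv_closed[OF w]] weyl_one by (simp add: fun_eq_iff)
  show "(inv\<^bsub>weyl_group D\<^esub> w) (w y) = y"
    using l_inv[OF w] weyl_mult[OF inv_closed[OF w] w] weyl_one by (simp add: fun_eq_iff)
qed

lemma double_cosets_words:
  assumes "I \<subseteq> S" "J \<subseteq> S"
  shows "double_cosets D I J = {{a \<circ> w \<circ> b | a b. a \<in> words I \<and> b \<in> words J} | w. w \<in> words S}"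
proof -
  have sub: "words I \<subseteq> words S" "words J \<subseteq> words S" using assms words_mono by auto
  have "parabolic_weyl_group D I <#>\<^bsub>weyl_group D\<^esub> (w <#\<^bsub>weyl_group D\<^esub> parabolic_weyl_group D J)
      = {a \<circ> w \<circ> b | a b. a \<in> words I \<and> b \<in> words J}" if w: "w \<in> words S" for w
  proof -
    have "a \<otimes>\<^bsub>weyl_group D\<^esub> (w \<otimes>\<^bsub>weyl_group D\<^esub> b) = a \<circ> w \<circ> b" if "a \<in> words I" "b \<in> words J" for a b
    proof -
      have "w \<circ> b \<in> words S" "a \<in> words S" "b \<in> words S" using that w sub words_comp by auto
      then show ?thesis using w by (simp add: weyl_mult carrier_weyl_group o_assoc)
    qed
    then show ?thesis
      unfolding parabolic_words[OF assms(1)] parabolic_words[OF assms(2)] set_mult_def l_coset_def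
      by (fastforce simp: set_eq_iff)
  qed
  then show ?thesis unfolding double_cosets_def carrier_weyl_group
    by (simp only: cong: rev_conj_cong)
qed

section \<open>The coroot lattice and the degree \<open>delta\<close>\<close>

lemma int_span_coroots:
  assumes "J \<subseteq> S" "\<And>\<alpha>. \<alpha> \<in> J \<Longrightarrow> coef \<alpha> y \<in> \<int>" "\<And>\<alpha>. \<alpha> \<in> S - J \<Longrightarrow> coef \<alpha> y = 0"
  shows "y \<in> int_span (ch ` J)"
proof -
  have inj: "inj_on ch J" using inj_coroot assms(1) S_R by (meson inj_on_subset subset_iff)
  have fin: "finite J" using assms(1) finite_S finite_subset by blast
  \<comment> \<open>\<open>int_span\<close> indexes coefficients by vectors, so each coroot is
    traced back to its simple root; the floor is exact on integral coefficients.\<close>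
  define c where "c v = \<lfloor>coef (the_inv_into J ch v) y\<rfloor>" for v
  have "y = (\<Sum>\<alpha>\<in>S. coef \<alpha> y *\<^sub>R ch \<alpha>)" by (rule coroot_expansion)
  also have "\<dots> = (\<Sum>\<alpha>\<in>J. coef \<alpha> y *\<^sub>R ch \<alpha>)"
    using assms by (intro sum.mono_neutral_right) auto
  also have "\<dots> = (\<Sum>\<alpha>\<in>J. of_int (c (ch \<alpha>)) *\<^sub>R ch \<alpha>)"
    using assms(2) inj by (intro sum.cong) (auto simp: c_def the_inv_into_f_f)
  also have "\<dots> = (\<Sum>v\<in>ch ` J. of_int (c v) *\<^sub>R v)"
    using inj by (simp add: sum.reindex)
  finally show ?thesis using fin unfolding int_span_def by blast
qed

lemma coef_int_span:
  assumes "\<mu> \<in> S" "J \<subseteq> S - {\<mu>}" "y \<in> int_span (ch ` J)"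
  shows "coef \<mu> y = 0"
proof -
  obtain A c where A: "finite A" "A \<subseteq> ch ` J" "y = (\<Sum>v\<in>A. of_int (c v) *\<^sub>R v)"
    using assms(3) by (auto simp: int_span_def)
  have "coef \<mu> (ch \<beta>) = 0" if "\<beta> \<in> J" for \<beta>
  proof -
    have "\<beta> \<in> S" "\<beta> \<noteq> \<mu>" using that assms(2) by auto
    then show ?thesis using coef_coroot[OF assms(1), of \<beta>] by simp
  qed
  then have "coef \<mu> v = 0" if "v \<in> A" for v using that A by auto
  then show ?thesis using A by (simp add: linear_sum[OF linear_coef] coef_simps)
qed

text \<open>Integrality of all coefficients gives existence of the integer described by
  \<open>eta\<close>; vanishing of \<open>coef \<mu>\<close> on the parabolic coroot lattice gives
  uniqueness.\<close>

lemma delta_coef: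
  assumes "\<alpha> \<in> S" "\<mu> \<in> S" "w \<in> words S"
  shows "of_int (delta D \<alpha> \<mu> w) = coef \<mu> (om \<alpha> - (inv\<^bsub>weyl_group D\<^esub> w) (om \<alpha>))"
proof -
  define y where "y = om \<alpha> - (inv\<^bsub>weyl_group D\<^esub> w) (om \<alpha>)"
  have int: "coef \<beta> y \<in> \<int>" if "\<beta> \<in> S" for \<beta>
    unfolding y_def using coef_coweight_Ints assms(1) that weyl_inv(1)[OF assms(3)] by blast
  then obtain k where k: "coef \<mu> y = of_int k" using assms(2) by (auto simp: Ints_def)
  have "delta D \<alpha> \<mu> w = k"
    unfolding delta_def eta_def y_def[symmetric] parabolic_coroot_lattice_def maximal_type_def
  proof (rule the_equality)
    show "y - of_int k *\<^sub>R ch \<mu> \<in> int_span (ch ` (S - {\<mu>}))"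
      using k int assms by (intro int_span_coroots) (auto simp: coef_simps coef_coroot)
  next
    fix l assume "y - of_int l *\<^sub>R ch \<mu> \<in> int_span (ch ` (S - {\<mu>}))"
    then have "coef \<mu> (y - of_int l *\<^sub>R ch \<mu>) = 0" using coef_int_span assms(2) by blast
    then show "l = k" using k assms by (simp add: coef_simps coef_coroot)
  qed
  then show ?thesis using k by (simp add: y_def)
qed

text \<open>Shows that the double cosets are exactly the level sets of \<delta> on the whole Weyl
  group.\<close>

lemma delta_eq_iff:
  assumes "\<alpha> \<in> S" "cominuscule D \<alpha>" "\<mu> \<in> S" "w \<in> words S" "w' \<in> words S"
  shows "delta D \<alpha> \<mu> w' = delta D \<alpha> \<mu> w \<longleftrightarrow>
    (\<exists>a\<in>words (S - {\<alpha>}). \<exists>b\<in>words (S - {\<mu>}). w' = a \<circ> w \<circ> b)" (is "?L \<longleftrightarrow> ?R")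
proof -
  let ?i = "\<lambda>w. inv\<^bsub>weyl_group D\<^esub> w"
  have sub: "words (S - {\<beta>}) \<subseteq> words S" "S - {\<beta>} \<subseteq> R" for \<beta>
    using S_R by (auto intro!: words_mono)
  have "real_of_int (delta D \<alpha> \<mu> w') = of_int (delta D \<alpha> \<mu> w) \<longleftrightarrow>
      coef \<mu> (?i w (om \<alpha>)) = coef \<mu> (?i w' (om \<alpha>))"
    using assms by (auto simp: delta_coef coef_simps)
  then have eq: "?L \<longleftrightarrow> coef \<mu> (?i w (om \<alpha>)) = coef \<mu> (?i w' (om \<alpha>))" by simp
  show ?thesis
  proof
    assume ?L
    then obtain a b where ab: "a \<in> words (S - {\<mu>})" "b \<in> words (S - {\<mu>})"
      "a (?i w (om \<alpha>)) = b (?i w' (om \<alpha>))"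
      using cominuscule_orbits[OF assms(1-3)] weyl_inv(1) assms(4,5) eq by blast
    obtain a' where a': "a' \<in> words (S - {\<mu>})" "\<And>y. a (a' y) = y" "\<And>y. a' (a y) = y"
      using words_inverse[OF sub(2) ab(1)] by blast
    obtain b' where b': "b' \<in> words (S - {\<mu>})" "\<And>y. b (b' y) = y" "\<And>y. b' (b y) = y"
      using words_inverse[OF sub(2) ab(2)] by blast
    \<comment> \<open>Built from \<open>b' = inverse of b\<close> so that the relation between the
      two orbit points makes \<open>g\<close> fix the coweight; solving for \<open>w'\<close> then
      gives the left factor \<open>g\<close> and the right factor
      \<open>a' \<circ> b\<close>.\<close>
    define g where "g = w' \<circ> (b' \<circ> (a \<circ> ?i w))"
    have "g \<in> words S" unfolding g_def
      using ab b' sub assms weyl_inv(1) by (intro words_comp) auto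
    moreover have "g (om \<alpha>) = om \<alpha>"
      using ab(3) b' weyl_inv assms(5) by (simp add: g_def)
    ultimately have "g \<in> words (S - {\<alpha>})" using stabilizer_coweight assms(1) by blast
    moreover have "a' \<circ> b \<in> words (S - {\<mu>})" using a' ab words_comp by blast
    moreover have "w' = g \<circ> w \<circ> (a' \<circ> b)"
      using a' b' weyl_inv assms(4) by (simp add: g_def fun_eq_iff)
    ultimately show ?R by blast
  next
    assume ?R
    then obtain a b where ab: "a \<in> words (S - {\<alpha>})" "b \<in> words (S - {\<mu>})" "w' = a \<circ> w \<circ> b" by blast
    \<comment> \<open>Since \<open>a\<close> fixes the coweight, it cancels, and \<open>b\<close>
      carries the orbit point of \<open>w'\<close> to that of \<open>w\<close> without changing the
      coefficient at \<mu>.\<close>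
    have "w' (?i w' (om \<alpha>)) = a (om \<alpha>)"
      using weyl_inv(2) assms(5) words_fix_coweight[OF assms(1) ab(1)] by simp
    moreover obtain a' where "\<And>y. a' (a y) = y"
      using words_inverse[OF sub(2) ab(1)] by blast
    ultimately have "w (b (?i w' (om \<alpha>))) = om \<alpha>" using ab(3) by (metis comp_apply)
    then have "b (?i w' (om \<alpha>)) = ?i w (om \<alpha>)" using weyl_inv(3)[OF assms(4)] by metis
    then show ?L using coef_words[OF assms(3) ab(2), of "?i w' (om \<alpha>)"] eq by simp
  qed
qed

end

theorem mainTheorem1:
  fixes D :: "('x::real_vector, 'y::real_vector) based_root_datum"
    and \<alpha>\<^sub>i \<alpha>\<^sub>m :: 'x
  assumes "semisimple_based_root_datum D"
    and "\<alpha>\<^sub>m \<in> simple_roots D"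
    and "\<alpha>\<^sub>i \<in> simple_roots D" and "cominuscule D \<alpha>\<^sub>i"
  defines "WQ \<equiv> minimal_coset_reps D (maximal_type D \<alpha>\<^sub>m)"
    and "DC \<equiv> double_cosets D (maximal_type D \<alpha>\<^sub>i) (maximal_type D \<alpha>\<^sub>m)"
  shows "(\<forall>E\<in>DC. \<exists>d::int. E \<inter> WQ = {w \<in> WQ. delta D \<alpha>\<^sub>i \<alpha>\<^sub>m w = d}) \<and>
         (\<forall>d::int. {w \<in> WQ. delta D \<alpha>\<^sub>i \<alpha>\<^sub>m w = d} \<noteq> {} \<longrightarrow>
            (\<exists>E\<in>DC. {w \<in> WQ. delta D \<alpha>\<^sub>i \<alpha>\<^sub>m w = d} = E \<inter> WQ))"
proof -
  interpret semisimple_datum D by unfold_locales fact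
  define E where "E w = {a \<circ> w \<circ> b | a b. a \<in> words (S - {\<alpha>\<^sub>i}) \<and> b \<in> words (S - {\<alpha>\<^sub>m})}" for w
  have DC: "DC = {E w | w. w \<in> words S}"
    unfolding DC_def E_def maximal_type_def by (rule double_cosets_words) auto
  have WQ: "WQ \<subseteq> words S"
    unfolding WQ_def minimal_coset_reps_def carrier_weyl_group by (rule Collect_subset)
  \<comment> \<open>Intersecting the level-set description of double cosets with \<open>WQ\<close>
    gives both halves of the claim: each coset has a representative \<open>w\<close>, and so does
    each non-empty level set.\<close>
  have fibre: "E w \<inter> WQ = {w' \<in> WQ. delta D \<alpha>\<^sub>i \<alpha>\<^sub>m w' = delta D \<alpha>\<^sub>i \<alpha>\<^sub>m w}" if "w \<in> words S" for w
  proof -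
    have "w' \<in> E w \<longleftrightarrow> delta D \<alpha>\<^sub>i \<alpha>\<^sub>m w' = delta D \<alpha>\<^sub>i \<alpha>\<^sub>m w" if "w' \<in> WQ" for w'
      unfolding delta_eq_iff[OF assms(3,4,2) \<open>w \<in> words S\<close> subsetD[OF WQ that]] E_def mem_Collect_eq
      by metis
    then show ?thesis by blast
  qed
  show ?thesis
  proof (intro conjI ballI allI impI)
    fix F assume "F \<in> DC"
    then obtain w where w: "F = E w" "w \<in> words S" unfolding DC mem_Collect_eq by (elim exE conjE)
    show "\<exists>d. F \<inter> WQ = {w \<in> WQ. delta D \<alpha>\<^sub>i \<alpha>\<^sub>m w = d}"
      unfolding w(1) fibre[OF w(2)] by (rule exI) (rule refl)
  next
    fix d assume "{w \<in> WQ. delta D \<alpha>\<^sub>i \<alpha>\<^sub>m w = d} \<noteq> {}"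
    then obtain w where w: "w \<in> WQ" "delta D \<alpha>\<^sub>i \<alpha>\<^sub>m w = d" by blast
    have wS: "w \<in> words S" using w(1) by (rule subsetD[OF WQ])
    show "\<exists>F\<in>DC. {w \<in> WQ. delta D \<alpha>\<^sub>i \<alpha>\<^sub>m w = d} = F \<inter> WQ"
    proof (rule bexI)
      show "{w \<in> WQ. delta D \<alpha>\<^sub>i \<alpha>\<^sub>m w = d} = E w \<inter> WQ" unfolding fibre[OF wS] w(2) ..
      show "E w \<in> DC" unfolding DC mem_Collect_eq using wS by (rule exI[of _ w, OF conjI[OF refl]])
    qed
  qed
qed

end
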